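(* For each $m\ge1$, the coefficient $c_m(w)$ is a polynomial in $\mathbb Q[w]$ of degree $m$. Moreover, for each $m\ge1$, the polynomial $c_m^*(w):=(-1)^m m!\,c_m(-w)$ has nonnegative integer coefficients, leading term $2^mw^m$, and vanishing constant term.
   Context: For $w\in\mathbb C$ define the coefficients $c_m(w)$, $m\ge1$, by the formal power series identity in $q$ $$\Bigl(1+2\sum_{n\ge1}q^{n^2}\Bigr)^w=\sum_{j\ge0}\binom wj 2^j\Bigl(\sum_{n\ge1}q^{n^2}\Bigr)^j=1+\sum_{m\ge1}c_m(w)q^m .$$ Equivalently, with $\theta(t)=\sum_{n\in\mathbb Z}e^{-\pi n^2t}$, one has $\theta(t)^w=1+\sum_{m\ge1}c_m(w)e^{-\pi mt}$ for large $t>0$. *)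

theory Defs
  imports Complex_Main "HOL-Computational_Algebra.Computational_Algebra"
begin

text \<open>The formal power series \<open>\<Sum>n\<ge>1. q ^ (n ^ 2)\<close>.\<close>

definition squares_fps :: "complex fps" where
  "squares_fps = Abs_fps (\<lambda>k. if \<exists>n\<ge>1. k = n ^ 2 then 1 else 0)"

lemma squares_fps_sums: "(\<lambda>n. fps_X ^ ((n + 1) ^ 2)) sums squares_fps"
proof -
  have "(\<lambda>n. \<Sum>i<n. (fps_X :: complex fps) ^ ((i + 1) ^ 2)) \<longlonglongrightarrow> squares_fps"
  proof (rule tendsto_fpsI)
    fix k
    show "eventually (\<lambda>n. fps_nth (\<Sum>i<n. (fps_X :: complex fps) ^ ((i + 1) ^ 2)) k
            = fps_nth squares_fps k) sequentially"
      using eventually_ge_at_top[of k]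
    proof eventually_elim
      case (elim n)
      have "fps_nth (\<Sum>i<n. (fps_X :: complex fps) ^ ((i + 1) ^ 2)) k
              = (\<Sum>i<n. if k = (i + 1) ^ 2 then 1 else 0)"
        by (simp add: fps_sum_nth fps_X_power_nth)
      also have "\<dots> = fps_nth squares_fps k"
      proof (cases "\<exists>m\<ge>1. k = m ^ 2")
        case True
        then obtain m where m: "m \<ge> 1" "k = m ^ 2" by blast
        have "m \<le> m ^ 2" by (simp add: power2_eq_square)
        with m elim have mn: "m - 1 < n" by linarith
        have "(\<Sum>i<n. if k = (i + 1) ^ 2 then 1 else 0)
                = (\<Sum>i<n. if i = m - 1 then 1 else (0 :: complex))"
          using m by (intro sum.cong refl) (auto simp: power2_eq_iff_nonneg)
        also have "\<dots> = 1" using mn by simp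
        finally show ?thesis using True by (simp add: squares_fps_def)
      next
        case False
        hence "k \<noteq> (i + 1) ^ 2" for i by (metis le_add2)
        with False show ?thesis by (simp add: squares_fps_def)
      qed
      finally show ?case .
    qed
  qed
  thus ?thesis unfolding sums_def .
qed

text \<open>
  The series \<open>(1 + 2 * \<Sum>n\<ge>1. q ^ (n ^ 2)) ^ w\<close> for a complex exponent \<open>w\<close>, by the binomial
  expansion \<open>\<Sum>j. (w gchoose j) * 2 ^ j * (\<Sum>n\<ge>1. q ^ (n ^ 2)) ^ j\<close>: \<open>fps_binomial w\<close> is
  \<open>\<Sum>j. (w gchoose j) * X ^ j\<close>, and \<open>oo\<close> substitutes a series without constant term for \<open>X\<close>.
\<close>

definition theta_power :: "complex \<Rightarrow> complex fps" where
  "theta_power w = fps_binomial w oo (2 * squares_fps)"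

lemma theta_power_of_nat: "theta_power (of_nat n) = (1 + 2 * squares_fps) ^ n"
proof -
  have 0: "fps_nth (2 * squares_fps) 0 = 0"
    by (simp add: squares_fps_def fps_mult_nth)
  show ?thesis
    unfolding theta_power_def fps_binomial_of_nat
    by (simp add: fps_compose_power[OF 0, symmetric] fps_compose_add_distrib fps_X_fps_compose_startby0[OF 0])
qed

definition theta_coeff :: "nat \<Rightarrow> complex \<Rightarrow> complex" where
  "theta_coeff m w = fps_nth (theta_power w) m"

definition theta_coeff_star :: "nat \<Rightarrow> complex \<Rightarrow> complex" where
  "theta_coeff_star m w = (-1) ^ m * fact m * theta_coeff m (- w)"

end

theory Submission
  imports Defs
begin

text \<open>
  Gauss's identity \<open>1 + 2 * (\<Sum>n\<ge>1. (-1) ^ n * q ^ n\<^sup>2) = (\<Prod>i\<ge>1. (1 - q ^ i) / (1 + q ^ i))\<close> shows that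
  minus the logarithmic derivative \<open>q * d/dq\<close> of the theta series at \<open>-q\<close> is
  \<open>(\<Sum>i\<ge>1. 2 * i * q ^ i / (1 - q ^ (2 * i)))\<close>, a series \<open>B = (\<Sum>k\<ge>1. b k * q ^ k)\<close> with
  nonnegative integer coefficients and \<open>b 1 = 2\<close>. The numbers \<open>(-1) ^ m * theta_coeff m (- w)\<close> are
  the coefficients of the series \<open>K\<close> with constant term \<open>1\<close> solving \<open>q * K' = w * B * K\<close>. Comparing
  coefficients gives a recurrence for \<open>theta_coeff_star\<close>, and the claims follow by induction.
  Gauss's identity is only needed modulo \<open>q ^ (n + 1)\<close> for every \<open>n\<close>, which is a consequence of a
  finite identity in the style of Shanks.
\<close>

section \<open>Congruences modulo powers of q and the operator \<open>q * d/dq\<close>\<close>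

lemma fps_X_power_dvd_iff:
  fixes f :: "'a::comm_ring_1 fps"
  shows "fps_X ^ n dvd f \<longleftrightarrow> (\<forall>k<n. fps_nth f k = 0)"
proof
  assume "fps_X ^ n dvd f"
  then show "\<forall>k<n. fps_nth f k = 0" by (auto simp: fps_X_power_mult_nth)
next
  assume "\<forall>k<n. fps_nth f k = 0"
  then have "f = fps_X ^ n * fps_shift n f"
    by (auto simp: fps_eq_iff fps_X_power_mult_nth)
  then show "fps_X ^ n dvd f" by (rule dvdI)
qed

lemma fps_eqI_mod_X_power:
  fixes f g :: "'a::comm_ring_1 fps"
  assumes "\<And>n. fps_X ^ Suc n dvd f - g"
  shows "f = g"
proof (rule fps_ext)
  fix n
  show "fps_nth f n = fps_nth g n"
    using assms[of n] unfolding fps_X_power_dvd_iff by simp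
qed

lemma fps_XD_mult: "fps_XD (f * g) = f * fps_XD g + fps_XD f * (g :: 'a::comm_ring_1 fps)"
  by (simp add: fps_XD_def algebra_simps)

text \<open>Logarithmic derivatives add up over a product; the form \<open>f i * l i\<close> avoids
  dividing by \<open>f i\<close>.\<close>

lemma fps_XD_prod_log:
  fixes f :: "'b \<Rightarrow> 'a::comm_ring_1 fps"
  assumes "finite I" "\<And>i. i \<in> I \<Longrightarrow> fps_XD (f i) = f i * l i"
  shows "fps_XD (prod f I) = prod f I * sum l I"
  using assms
proof (induction I rule: finite_induct)
  case empty
  then show ?case by (simp add: fps_XD_def)
next
  case (insert i I)
  then show ?case by (simp add: fps_XD_mult algebra_simps)
qed

lemma fps_X_power_dvd_XD:
  fixes f :: "'a::comm_ring_1 fps"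
  assumes "fps_X ^ n dvd f"
  shows "fps_X ^ n dvd fps_XD f"
  using assms unfolding fps_X_power_dvd_iff by simp

lemma fps_XD_compose_uminus_X:
  "fps_XD (f oo - fps_X) = (fps_XD f oo - fps_X :: 'a::comm_ring_1 fps)"
  by (simp add: fps_eq_iff fps_compose_uminus')

section \<open>Gauss's identity\<close>

text \<open>If \<open>F s\<close> denotes the right-hand side, the summand is
  \<open>F (Suc j) - F j\<close>, and \<open>F 0 = 0\<close> because its product contains the factor
  \<open>1 - q ^ 0\<close>.\<close>

lemma shanks_telescoping:
  fixes q :: "'a::comm_ring_1" and n :: nat
  defines "D \<equiv> \<lambda>s. \<Prod>i<s. 1 + q ^ i"
  assumes "s \<le> Suc n"
  shows "(\<Sum>j<s. (-1) ^ j * D j * (\<Prod>i\<in>{j<..n}. 1 - q ^ i) * q ^ (j * Suc n) *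
            (q ^ j * (1 - q ^ Suc n) - (1 + q ^ Suc n))) =
         (-1) ^ s * D s * (\<Prod>i\<in>{s..n}. 1 - q ^ i) * q ^ (s * Suc n)"
  using assms(2)
proof (induction s)
  case 0
  have "(\<Prod>i\<in>{0..n}. 1 - q ^ i) = 0"
    by (rule prod_zero) (auto intro!: bexI[of _ 0])
  then show ?case by simp
next
  case (Suc s)
  define P where "P = (\<Prod>i\<in>{s<..n}. 1 - q ^ i)"
  have "{s..n} = insert s {s<..n}" using Suc.prems by auto
  then have P: "(\<Prod>i\<in>{s..n}. 1 - q ^ i) = (1 - q ^ s) * P" by (simp add: P_def)
  have P': "(\<Prod>i\<in>{Suc s..n}. 1 - q ^ i) = P"
    by (simp add: P_def atLeastSucAtMost_greaterThanAtMost)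
  have D: "D (Suc s) = D s * (1 + q ^ s)" by (simp add: D_def)
  have q: "q ^ (Suc s * Suc n) = q ^ (s * Suc n) * q ^ Suc n"
    unfolding mult_Suc power_add by (rule mult.commute)
  show ?case
    unfolding sum.lessThan_Suc Suc.IH[OF Suc_leD[OF Suc.prems]] P P' D q P_def[symmetric]
    by (simp add: algebra_simps)
qed

text \<open>Shanks's finite form of Gauss's identity, with denominators cleared. In the induction,
  the right-hand side for \<open>Suc n\<close> minus \<open>1 + q ^ Suc n\<close> times the one for
  \<open>n\<close> telescopes, which leaves exactly the contribution of the new square.\<close>

lemma shanks_identity:
  fixes q :: "'a::comm_ring_1"
  defines "D \<equiv> \<lambda>s. \<Prod>i<s. 1 + q ^ i"
  shows "(\<Prod>i\<in>{1..n}. 1 + q ^ i) * (1 + 2 * (\<Sum>j\<in>{1..n}. (-1) ^ j * q ^ (j ^ 2))) =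
         (\<Sum>s\<le>n. (-1) ^ s * D s * (\<Prod>i\<in>{s<..n}. 1 - q ^ i) * q ^ (s * Suc n))"
proof (induction n)
  case 0
  then show ?case by (simp add: D_def)
next
  case (Suc n)
  define C where "C = (\<lambda>n. \<Prod>i\<in>{1..n}. 1 + q ^ i)"
  define S where "S = (\<lambda>n. 1 + 2 * (\<Sum>j\<in>{1..n}. (-1) ^ j * q ^ (j ^ 2)))"
  define t where "t = (\<lambda>n s. (-1) ^ s * D s * (\<Prod>i\<in>{s<..n}. 1 - q ^ i) * q ^ (s * Suc n))"
  have t_Suc: "t (Suc n) s - (1 + q ^ Suc n) * t n s =
      (-1) ^ s * D s * (\<Prod>i\<in>{s<..n}. 1 - q ^ i) * q ^ (s * Suc n) *
        (q ^ s * (1 - q ^ Suc n) - (1 + q ^ Suc n))" if "s \<le> n" for s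
  proof -
    have "{s<..Suc n} = insert (Suc n) {s<..n}" using that by auto
    then have 1: "(\<Prod>i\<in>{s<..Suc n}. 1 - q ^ i) = (1 - q ^ Suc n) * (\<Prod>i\<in>{s<..n}. 1 - q ^ i)"
      by simp
    have 2: "q ^ (s * Suc (Suc n)) = q ^ (s * Suc n) * q ^ s"
      by (simp only: mult_Suc_right power_add mult_ac)
    show ?thesis unfolding t_def 1 2 by (simp add: algebra_simps)
  qed
  have sq: "(Suc n)\<^sup>2 = Suc n * Suc n" by (simp add: power2_eq_square)
  \<comment> \<open>The indices \<open>s \<le> n\<close> telescope; the index
    \<open>s = Suc n\<close> has no counterpart at level \<open>n\<close> and is evaluated
    separately.\<close>
  have "(\<Sum>s\<le>Suc n. t (Suc n) s) - (1 + q ^ Suc n) * (\<Sum>s\<le>n. t n s) =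
        (\<Sum>s\<le>n. t (Suc n) s - (1 + q ^ Suc n) * t n s) + t (Suc n) (Suc n)"
    by (simp add: sum_subtractf sum_distrib_left)
  also have "(\<Sum>s\<le>n. t (Suc n) s - (1 + q ^ Suc n) * t n s) =
        (\<Sum>s<Suc n. (-1) ^ s * D s * (\<Prod>i\<in>{s<..n}. 1 - q ^ i) * q ^ (s * Suc n) *
        (q ^ s * (1 - q ^ Suc n) - (1 + q ^ Suc n)))"
    unfolding lessThan_Suc_atMost by (intro sum.cong refl t_Suc) simp
  also have "\<dots> = (-1) ^ Suc n * D (Suc n) * q ^ ((Suc n)\<^sup>2)"
    using shanks_telescoping[of "Suc n" n q] unfolding sq D_def by simp
  also have "t (Suc n) (Suc n) = (-1) ^ Suc n * D (Suc n) * (q ^ ((Suc n)\<^sup>2) * q ^ Suc n)"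
  proof -
    have "q ^ (Suc n * Suc (Suc n)) = q ^ (Suc n * Suc n) * q ^ Suc n"
      by (simp only: mult_Suc_right[of "Suc n" "Suc n"] power_add mult.commute)
    then show ?thesis unfolding t_def sq by (simp del: power_Suc mult_Suc mult_Suc_right)
  qed
  also have "(-1) ^ Suc n * D (Suc n) * q ^ ((Suc n)\<^sup>2) + \<dots> =
      (-1) ^ Suc n * q ^ ((Suc n)\<^sup>2) * D (Suc (Suc n))"
    by (simp add: D_def algebra_simps)
  \<comment> \<open>The factor of \<open>D\<close> at \<open>i = 0\<close> is
    \<open>1 + q ^ 0 = 2\<close>, the source of the 2 in the theta series.\<close>
  also have "D (Suc (Suc n)) = 2 * C (Suc n)"
  proof -
    have "{..<Suc (Suc n)} = insert 0 {1..Suc n}" by auto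
    then show ?thesis by (simp add: D_def C_def)
  qed
  finally have "(\<Sum>s\<le>Suc n. t (Suc n) s) =
      (1 + q ^ Suc n) * (\<Sum>s\<le>n. t n s) + (-1) ^ Suc n * q ^ ((Suc n)\<^sup>2) * (2 * C (Suc n))"
    by (simp add: algebra_simps)
  also have "(\<Sum>s\<le>n. t n s) = C n * S n"
    using Suc.IH unfolding C_def S_def t_def ..
  also have "(1 + q ^ Suc n) * (C n * S n) + (-1) ^ Suc n * q ^ ((Suc n)\<^sup>2) * (2 * C (Suc n)) =
      C (Suc n) * S (Suc n)"
  proof -
    have "C (Suc n) = C n * (1 + q ^ Suc n)" by (simp add: C_def)
    moreover have "S (Suc n) = S n + 2 * ((-1) ^ Suc n * q ^ ((Suc n)\<^sup>2))"
      by (simp add: S_def algebra_simps del: power_Suc)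
    ultimately show ?thesis by (simp only:) (simp add: algebra_simps del: power_Suc)
  qed
  finally show ?case unfolding C_def S_def t_def ..
qed

text \<open>The theta series at -q. Since \<open>n\<close> and \<open>n ^ 2\<close> have the same
  parity, its signs are \<open>(-1) ^ n\<close>.\<close>

definition theta_alt :: "complex fps" where
  "theta_alt = (1 + 2 * squares_fps) oo - fps_X"

lemma two_fps_mult_nth [simp]: "fps_nth (2 * f) n = 2 * fps_nth (f :: 'a::comm_ring_1 fps) n"
  by (simp add: numeral_fps_const)

lemma theta_alt_0 [simp]: "fps_nth theta_alt 0 = 1"
  by (simp add: theta_alt_def squares_fps_def)

lemma theta_alt_mod:
  "fps_X ^ Suc n dvd theta_alt - (1 + 2 * (\<Sum>j\<in>{1..n}. (-1) ^ j * fps_X ^ (j ^ 2)))"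
  unfolding fps_X_power_dvd_iff
proof (intro allI impI)
  fix k assume "k < Suc n"
  have m1: "(-1) ^ j * f = fps_const ((-1) ^ j) * f" for j and f :: "complex fps"
    by (metis fps_const_1_eq_1 fps_const_neg fps_const_power)
  have "fps_nth (\<Sum>j\<in>{1..n}. (-1) ^ j * (fps_X :: complex fps) ^ (j ^ 2)) k =
      (\<Sum>j\<in>{1..n}. if k = j ^ 2 then (-1) ^ j else 0)"
    unfolding m1 by (simp add: fps_sum_nth fps_X_power_nth if_distrib cong: if_cong)
  also have "\<dots> = (-1) ^ k * fps_nth squares_fps k"
  proof (cases "\<exists>m\<ge>1. k = m ^ 2")
    case True
    then obtain m where m: "m \<ge> 1" "k = m ^ 2" by blast
    have "m \<le> m ^ 2" by (simp add: power2_eq_square)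
    with m \<open>k < Suc n\<close> have mn: "m \<in> {1..n}" by simp
    have "(\<Sum>j\<in>{1..n}. if k = j ^ 2 then (-1) ^ j else 0) =
        (\<Sum>j\<in>{1..n}. if j = m then (-1) ^ m else (0 :: complex))"
      using m by (intro sum.cong refl) (auto simp: power2_eq_iff_nonneg)
    also have "\<dots> = (-1) ^ m" using mn by simp
    also have "\<dots> = (-1) ^ k" using m by (cases "even m") auto
    finally show ?thesis using True by (simp add: squares_fps_def)
  next
    case False
    then show ?thesis by (auto simp: squares_fps_def intro!: sum.neutral)
  qed
  finally show "fps_nth (theta_alt - (1 + 2 * (\<Sum>j\<in>{1..n}. (-1) ^ j * fps_X ^ (j ^ 2)))) k = 0"
    by (simp add: theta_alt_def fps_compose_uminus')
qed

text \<open>Modulo \<open>fps_X ^ Suc n\<close>, only the term \<open>s = 0\<close> of Shanks's sum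
  survives, since the others carry the factor \<open>fps_X ^ (s * Suc n)\<close>.\<close>

lemma theta_alt_gauss:
  "fps_X ^ Suc n dvd
     theta_alt * (\<Prod>i\<in>{1..n}. 1 + fps_X ^ i) - (\<Prod>i\<in>{1..n}. 1 - fps_X ^ i)"
proof -
  let ?C = "\<Prod>i\<in>{1..n}. 1 + (fps_X :: complex fps) ^ i"
  let ?A = "\<Prod>i\<in>{1..n}. 1 - (fps_X :: complex fps) ^ i"
  let ?S = "1 + 2 * (\<Sum>j\<in>{1..n}. (-1) ^ j * (fps_X :: complex fps) ^ (j ^ 2))"
  define t :: "nat \<Rightarrow> complex fps" where
    "t = (\<lambda>s. (-1) ^ s * (\<Prod>i<s. 1 + fps_X ^ i) * (\<Prod>i\<in>{s<..n}. 1 - fps_X ^ i))"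
  have "?C * ?S = (\<Sum>s\<le>n. t s * fps_X ^ (s * Suc n))"
    unfolding shanks_identity t_def ..
  also have "\<dots> = t 0 + (\<Sum>s<n. t (Suc s) * fps_X ^ (Suc s * Suc n))"
    by (subst sum.atMost_shift) simp
  also have "t 0 = ?A"
    by (simp add: t_def atLeastSucAtMost_greaterThanAtMost)
  finally have "?C * ?S - ?A = (\<Sum>s<n. t (Suc s) * fps_X ^ (Suc s * Suc n))" by simp
  also have "fps_X ^ Suc n dvd \<dots>"
    by (intro dvd_sum dvd_mult le_imp_power_dvd) simp
  finally have "fps_X ^ Suc n dvd ?C * ?S - ?A" .
  moreover have "fps_X ^ Suc n dvd ?C * (theta_alt - ?S)"
    by (intro dvd_mult theta_alt_mod)
  ultimately have "fps_X ^ Suc n dvd (?C * ?S - ?A) + ?C * (theta_alt - ?S)" by (rule dvd_add)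
  then show ?thesis by (simp add: algebra_simps)
qed

section \<open>The logarithmic derivative\<close>

text \<open>
  For \<open>1 \<le> i \<le> k\<close>, the condition \<open>2 * i dvd k - i\<close> says that \<open>k\<close> is an odd multiple of \<open>i\<close>.
\<close>

definition log_coeff :: "nat \<Rightarrow> nat" where
  "log_coeff k = (\<Sum>i\<in>{1..k}. if 2 * i dvd k - i then 2 * i else 0)"

lemma log_coeff_0 [simp]: "log_coeff 0 = 0"
  by (simp add: log_coeff_def)

lemma log_coeff_1 [simp]: "log_coeff (Suc 0) = 2"
  by (simp add: log_coeff_def)

text \<open>For \<open>i \<ge> 1\<close> this is the geometric series of
  \<open>1 / (1 - q ^ (2 * i))\<close>.\<close>

definition geom_fps :: "nat \<Rightarrow> complex fps" where
  "geom_fps i = Abs_fps (\<lambda>k. if 2 * i dvd k then 1 else 0)"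

lemma geom_fps_mult:
  assumes "i \<ge> 1"
  shows "(1 - fps_X ^ i) * ((1 + fps_X ^ i) * geom_fps i) = 1"
proof -
  have "(1 - fps_X ^ i) * (1 + fps_X ^ i) = 1 - (fps_X :: complex fps) ^ (2 * i)"
    unfolding mult_2 power_add by (simp add: algebra_simps)
  moreover have "(1 - fps_X ^ (2 * i)) * geom_fps i = 1"
  proof (rule fps_ext)
    fix k
    have "2 * i dvd k - 2 * i \<longleftrightarrow> 2 * i dvd k" if "\<not> k < 2 * i"
      using that by (simp add: dvd_minus_self)
    then show "fps_nth ((1 - fps_X ^ (2 * i)) * geom_fps i) k = fps_nth 1 k"
      using assms
      by (auto simp: algebra_simps fps_X_power_mult_nth geom_fps_def dest: dvd_imp_le)
  qed
  ultimately show ?thesis by (simp only: mult.assoc[symmetric])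
qed

lemma log_coeff_mod:
  "fps_X ^ Suc n dvd
     Abs_fps (\<lambda>k. of_nat (log_coeff k)) - (\<Sum>i\<in>{1..n}. of_nat (2 * i) * (fps_X ^ i * geom_fps i))"
  unfolding fps_X_power_dvd_iff
proof (intro allI impI)
  fix k assume k: "k < Suc n"
  \<comment> \<open>The case \<open>k < i\<close> must be kept apart: there truncated subtraction
    gives \<open>k - i = 0\<close>, which \<open>2 * i\<close> divides.\<close>
  have "fps_nth (\<Sum>i\<in>{1..n}. of_nat (2 * i) * (fps_X ^ i * geom_fps i)) k =
      (\<Sum>i\<in>{1..n}. if k < i then 0 else if 2 * i dvd k - i then of_nat (2 * i) else 0)"
    by (simp add: fps_sum_nth fps_X_power_mult_nth geom_fps_def fps_of_nat[symmetric] mult.assoc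
          del: fps_of_nat)
       (intro sum.cong refl, auto)
  also have "\<dots> = (\<Sum>i\<in>{1..k}. if 2 * i dvd k - i then of_nat (2 * i) else 0)"
    using k by (intro sum.mono_neutral_cong_right) auto
  also have "\<dots> = of_nat (log_coeff k)"
    by (simp add: log_coeff_def if_distrib cong: if_cong)
  finally show "fps_nth (Abs_fps (\<lambda>k. of_nat (log_coeff k)) -
      (\<Sum>i\<in>{1..n}. of_nat (2 * i) * (fps_X ^ i * geom_fps i))) k = 0"
    by simp
qed

text \<open>Differentiating Gauss's congruence \<open>T * C = A\<close> and using it once more to
  replace \<open>A\<close> by \<open>T * C\<close> gives \<open>(fps_XD T + T * B) * C = 0\<close>
  modulo every power of q, where \<open>B\<close> is the difference of the logarithmic derivatives
  of \<open>C\<close> and \<open>A\<close>. The factor \<open>C\<close> is then cancelled.\<close>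

lemma fps_XD_theta_alt:
  "fps_XD theta_alt = - (theta_alt * Abs_fps (\<lambda>k. of_nat (log_coeff k)))"
proof (rule fps_eqI_mod_X_power)
  fix n
  define x :: "complex fps" where "x = fps_X"
  define T where "T = theta_alt"
  define C where "C = (\<Prod>i\<in>{1..n}. 1 + x ^ i)"
  define A where "A = (\<Prod>i\<in>{1..n}. 1 - x ^ i)"
  \<comment> \<open>For \<open>i \<ge> 1\<close>, \<open>L i\<close> and \<open>M i\<close> are
    \<open>i * x ^ i / (1 + x ^ i)\<close> and \<open>- i * x ^ i / (1 - x ^ i)\<close>, written
    over the common denominator \<open>1 - x ^ (2 * i)\<close> so that their difference is a term of
    \<open>B'\<close>.\<close>
  define L where "L = (\<lambda>i. of_nat i * x ^ i * ((1 - x ^ i) * geom_fps i))"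
  define M where "M = (\<lambda>i. - of_nat i * x ^ i * ((1 + x ^ i) * geom_fps i))"
  define B where "B = Abs_fps (\<lambda>k. of_nat (log_coeff k) :: complex)"
  define B' where "B' = (\<Sum>i\<in>{1..n}. of_nat (2 * i) * (x ^ i * geom_fps i))"
  have xd: "fps_XD (x ^ i) = of_nat i * x ^ i" for i
    by (simp add: x_def fps_eq_iff fps_X_power_nth fps_of_nat[symmetric] del: fps_of_nat)
  have xd1: "fps_XD 1 = (0 :: complex fps)" by (simp add: fps_XD_def)
  have g: "(1 - x ^ i) * ((1 + x ^ i) * geom_fps i) = 1" if "i \<in> {1..n}" for i
    using geom_fps_mult[of i] that by (simp add: x_def)
  have C': "fps_XD C = C * sum L {1..n}" unfolding C_def
  proof (rule fps_XD_prod_log)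
    fix i assume i: "i \<in> {1..n}"
    have "(1 + x ^ i) * L i = of_nat i * x ^ i * ((1 - x ^ i) * ((1 + x ^ i) * geom_fps i))"
      unfolding L_def by (simp only: mult_ac)
    then show "fps_XD (1 + x ^ i) = (1 + x ^ i) * L i"
      by (simp add: xd xd1 g[OF i])
  qed simp
  have A': "fps_XD A = A * sum M {1..n}" unfolding A_def
  proof (rule fps_XD_prod_log)
    fix i assume i: "i \<in> {1..n}"
    have "(1 - x ^ i) * M i = - of_nat i * x ^ i * ((1 - x ^ i) * ((1 + x ^ i) * geom_fps i))"
      unfolding M_def by (simp only: mult_ac)
    moreover have "fps_XD (1 - x ^ i) = fps_XD 1 - fps_XD (x ^ i)"
      by (simp add: fps_XD_def algebra_simps)
    ultimately show "fps_XD (1 - x ^ i) = (1 - x ^ i) * M i"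
      by (simp add: xd xd1 g[OF i])
  qed simp
  have LM: "sum L {1..n} - sum M {1..n} = B'"
    unfolding B'_def sum_subtractf[symmetric]
    by (intro sum.cong refl) (simp add: L_def M_def algebra_simps)
  have gauss: "fps_X ^ Suc n dvd T * C - A"
    using theta_alt_gauss[of n] by (simp add: T_def C_def A_def x_def)
  have "fps_X ^ Suc n dvd fps_XD (T * C - A)" by (rule fps_X_power_dvd_XD[OF gauss])
  moreover have "fps_XD (T * C - A) = fps_XD (T * C) - fps_XD A"
    by (simp add: fps_XD_def algebra_simps)
  ultimately have "fps_X ^ Suc n dvd T * (C * sum L {1..n}) + fps_XD T * C - A * sum M {1..n}"
    by (simp add: fps_XD_mult C' A')
  moreover have "fps_X ^ Suc n dvd (T * C - A) * sum M {1..n}"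
    using gauss by (rule dvd_mult2)
  moreover have "fps_X ^ Suc n dvd (B - B') * (T * C)"
    unfolding B_def B'_def x_def by (intro dvd_mult2 log_coeff_mod)
  ultimately have "fps_X ^ Suc n dvd
      (T * (C * sum L {1..n}) + fps_XD T * C - A * sum M {1..n}) - (T * C - A) * sum M {1..n}
      + (B - B') * (T * C)"
    by (rule dvd_add[OF dvd_diff])
  also have "\<dots> = (fps_XD T + T * B) * C"
    unfolding LM[symmetric] by (simp add: algebra_simps)
  finally have "fps_X ^ Suc n dvd (fps_XD T + T * B) * C" .
  \<comment> \<open>Constant term 1 makes \<open>C\<close> invertible.\<close>
  moreover have "fps_nth C 0 = 1"
    unfolding C_def x_def by (induction n) simp_all
  then obtain D where "1 = C * D"
    using fps_unit_dvd_left[of C] by auto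
  ultimately have "fps_X ^ Suc n dvd fps_XD T + T * B"
    by (metis dvd_mult2 mult.assoc mult.right_neutral)
  then show "fps_X ^ Suc n dvd
      fps_XD theta_alt - - (theta_alt * Abs_fps (\<lambda>k. of_nat (log_coeff k)))"
    by (simp add: T_def B_def)
qed

section \<open>The recurrence for the coefficients\<close>

text \<open>The binomial series satisfies \<open>(1 + X) * f' = w * f\<close>; substitute
  \<open>2 * squares_fps\<close> for X and apply the chain rule.\<close>

lemma fps_XD_theta_power:
  "(1 + 2 * squares_fps) * fps_XD (theta_power w) =
     fps_const w * theta_power w * fps_XD (1 + 2 * squares_fps)"
proof -
  define g where "g = 2 * squares_fps"
  have 0: "fps_nth g 0 = 0" by (simp add: g_def squares_fps_def)
  have "(1 + fps_X) * fps_deriv (fps_binomial w) = fps_const w * fps_binomial w"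
    by (simp add: fps_binomial_deriv)
  then have "((1 + fps_X) * fps_deriv (fps_binomial w)) oo g = (fps_const w * fps_binomial w) oo g"
    by simp
  then have "(1 + g) * (fps_deriv (fps_binomial w) oo g) = fps_const w * theta_power w"
    by (simp add: fps_compose_mult_distrib[OF 0] fps_compose_add_distrib theta_power_def g_def[symmetric]
          fps_X_fps_compose_startby0[OF 0])
  then have "(1 + g) * ((fps_deriv (fps_binomial w) oo g) * fps_deriv g) =
      fps_const w * theta_power w * fps_deriv g"
    by (simp only: mult.assoc[symmetric])
  then have "fps_X * ((1 + g) * ((fps_deriv (fps_binomial w) oo g) * fps_deriv g)) =
      fps_X * (fps_const w * theta_power w * fps_deriv g)"
    by (simp only:)
  then show ?thesis
    unfolding theta_power_def g_def[symmetric] fps_XD_def o_def fps_compose_deriv[OF 0]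
    by (simp only: fps_deriv_add fps_deriv_1 add_0_left mult_ac)
qed

text \<open>The substitution of -q commutes with \<open>fps_XD\<close>. The minus sign of the
  exponent cancels that of \<open>fps_XD_theta_alt\<close>, and the nonzero factor
  \<open>theta_alt\<close> can be cancelled.\<close>

lemma fps_XD_theta_power_alt:
  "fps_XD (theta_power (- w) oo - fps_X) =
     fps_const w * Abs_fps (\<lambda>k. of_nat (log_coeff k)) * (theta_power (- w) oo - fps_X)"
proof -
  have 0: "fps_nth (- fps_X :: complex fps) 0 = 0" by simp
  let ?K = "theta_power (- w) oo - fps_X"
  have "((1 + 2 * squares_fps) * fps_XD (theta_power (- w))) oo - fps_X =
      (fps_const (- w) * theta_power (- w) * fps_XD (1 + 2 * squares_fps)) oo - fps_X"
    unfolding fps_XD_theta_power ..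
  then have "theta_alt * fps_XD ?K = fps_const (- w) * ?K * fps_XD theta_alt"
    unfolding fps_compose_mult_distrib[OF 0] fps_XD_compose_uminus_X[symmetric]
      theta_alt_def[symmetric] fps_const_compose .
  also have "\<dots> = theta_alt * (fps_const w * Abs_fps (\<lambda>k. of_nat (log_coeff k)) * ?K)"
    by (simp add: fps_XD_theta_alt fps_const_neg[symmetric] mult_ac del: fps_const_neg)
  finally show ?thesis
    using theta_alt_0 by (metis fps_zero_nth mult_cancel_left zero_neq_one)
qed

lemma theta_coeff_star_0 [simp]: "theta_coeff_star 0 w = 1"
  by (simp add: theta_coeff_star_def theta_coeff_def theta_power_def)

text \<open>Comparison of coefficients in the differential equation, scaled by
  \<open>fact n\<close>. The quotient \<open>fact n div fact k\<close> is exact for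
  \<open>k \<le> n\<close>, so all weights are natural numbers.\<close>

lemma theta_coeff_star_Suc:
  "theta_coeff_star (Suc n) w =
     w * (\<Sum>k\<le>n. of_nat (log_coeff (Suc n - k) * (fact n div fact k)) * theta_coeff_star k w)"
proof -
  define K where "K = theta_power (- w) oo - fps_X"
  have star: "theta_coeff_star k w = fact k * fps_nth K k" for k
    by (simp add: theta_coeff_star_def theta_coeff_def K_def fps_compose_uminus')
  have "of_nat (Suc n) * fps_nth K (Suc n) =
      fps_nth (fps_const w * (K * Abs_fps (\<lambda>k. of_nat (log_coeff k)))) (Suc n)"
    using fps_XD_theta_power_alt[of w, folded K_def]
    by (metis fps_XD_nth mult.assoc mult.commute)
  also have "\<dots> = w * (\<Sum>k\<le>Suc n. of_nat (log_coeff (Suc n - k)) * fps_nth K k)"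
    unfolding fps_mult_left_const_nth
    by (simp add: fps_mult_nth[of K] atLeast0AtMost mult_ac del: sum.atMost_Suc)
  \<comment> \<open>The term \<open>k = Suc n\<close> vanishes because
    \<open>log_coeff 0 = 0\<close>.\<close>
  also have "\<dots> = w * (\<Sum>k\<le>n. of_nat (log_coeff (Suc n - k)) * fps_nth K k)"
    by simp
  finally have "theta_coeff_star (Suc n) w =
      fact n * (w * (\<Sum>k\<le>n. of_nat (log_coeff (Suc n - k)) * fps_nth K k))"
    unfolding star fact_Suc by (simp add: mult_ac del: of_nat_Suc)
  also have "\<dots> = w * (\<Sum>k\<le>n. of_nat (log_coeff (Suc n - k)) * (fact n * fps_nth K k))"
    by (simp add: sum_distrib_left mult_ac)
  also have "(\<Sum>k\<le>n. of_nat (log_coeff (Suc n - k)) * (fact n * fps_nth K k)) =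
      (\<Sum>k\<le>n. of_nat (log_coeff (Suc n - k) * (fact n div fact k)) * theta_coeff_star k w)"
  proof (rule sum.cong)
    fix k assume "k \<in> {..n}"
    then have "(fact n div fact k) * fact k = (fact n :: nat)"
      by (simp add: fact_dvd)
    then have "of_nat (fact n div fact k) * fact k = (fact n :: complex)"
      by (metis of_nat_fact of_nat_mult)
    then show "of_nat (log_coeff (Suc n - k)) * (fact n * fps_nth K k) =
        of_nat (log_coeff (Suc n - k) * (fact n div fact k)) * theta_coeff_star k w"
      by (simp add: star mult_ac)
  qed simp
  finally show ?thesis .
qed

section \<open>Integrality, nonnegativity and leading term\<close>

text \<open>By the recurrence, the next polynomial is w times a nonnegative integer combination
  \<open>Q\<close> of the earlier ones. Only \<open>k = n\<close> reaches degree \<open>n\<close>,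
  and its weight \<open>log_coeff 1 = 2\<close> doubles the leading coefficient. The factor w, that
  is \<open>pCons 0\<close>, removes the constant term.\<close>

lemma theta_coeff_star_poly:
  "\<exists>p :: int poly. (\<forall>i. coeff p i \<ge> 0) \<and> degree p = m \<and> lead_coeff p = 2 ^ m \<and>
     (m \<ge> 1 \<longrightarrow> coeff p 0 = 0) \<and> (\<forall>w. theta_coeff_star m w = poly (map_poly of_int p) w)"
proof (induction m rule: less_induct)
  case (less m)
  show ?case
  proof (cases m)
    case 0
    then show ?thesis by (intro exI[of _ 1]) (auto simp: coeff_1)
  next
    case (Suc n)
    have "\<forall>k\<in>{..n}. \<exists>p :: int poly. (\<forall>i. coeff p i \<ge> 0) \<and> degree p = k \<and>
        lead_coeff p = 2 ^ k \<and> (\<forall>w. theta_coeff_star k w = poly (map_poly of_int p) w)"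
      using less.IH Suc by (meson atMost_iff less_Suc_eq_le)
    from bchoice[OF this] obtain P :: "nat \<Rightarrow> int poly" where
      P': "\<forall>k\<in>{..n}. (\<forall>i. coeff (P k) i \<ge> 0) \<and> degree (P k) = k \<and> lead_coeff (P k) = 2 ^ k \<and>
        (\<forall>w. theta_coeff_star k w = poly (map_poly of_int (P k)) w)"
      by blast
    have P: "coeff (P k) i \<ge> 0" "degree (P k) = k" "lead_coeff (P k) = 2 ^ k"
      "theta_coeff_star k w = poly (map_poly of_int (P k)) w" if "k \<le> n" for k i w
      using P' that unfolding atMost_iff Ball_def by blast+
    define a :: "nat \<Rightarrow> nat" where "a = (\<lambda>k. log_coeff (Suc n - k) * (fact n div fact k))"
    define Q where "Q = (\<Sum>k\<le>n. smult (int (a k)) (P k))"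
    have nonneg: "coeff Q i \<ge> 0" for i
      unfolding Q_def coeff_sum by (intro sum_nonneg) (simp add: P(1))
    have degle: "degree Q \<le> n"
      unfolding Q_def by (intro degree_sum_le) (use P(2) le_trans[OF degree_smult_le] in auto)
    have "coeff Q n = (\<Sum>k\<le>n. if k = n then 2 ^ Suc n else 0)"
      unfolding Q_def coeff_sum
    proof (rule sum.cong)
      fix k assume k: "k \<in> {..n}"
      show "coeff (smult (int (a k)) (P k)) n = (if k = n then 2 ^ Suc n else 0)"
      proof (cases "k = n")
        case True
        then show ?thesis using P(2)[of n] P(3)[of n] by (simp add: a_def)
      next
        case False
        then show ?thesis using k P(2)[of k] by (simp add: coeff_eq_0)
      qed
    qed simp
    then have lead: "coeff Q n = 2 ^ Suc n" by simp
    then have deg: "degree Q = n" using degle by (intro antisym le_degree) auto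
    have "theta_coeff_star m w = poly (map_poly of_int (pCons 0 Q)) w" for w
    proof -
      have "map_poly of_int Q = (\<Sum>k\<le>n. smult (of_nat (a k)) (map_poly of_int (P k)) :: complex poly)"
        by (rule poly_eqI) (simp add: Q_def coeff_map_poly coeff_sum)
      moreover have "map_poly of_int (pCons 0 Q) = (pCons 0 (map_poly of_int Q) :: complex poly)"
        by (simp add: map_poly_pCons)
      ultimately show ?thesis
        unfolding Suc theta_coeff_star_Suc by (simp add: a_def P(4) poly_sum)
    qed
    moreover have "Q \<noteq> 0" using lead by auto
    ultimately show ?thesis
      using nonneg lead deg Suc
      by (intro exI[of _ "pCons 0 Q"]) (auto simp: coeff_pCons split: nat.splits)
  qed
qed

theorem theorem3p1:
  fixes m :: nat
  assumes "m \<ge> 1"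
  shows "(\<exists>p :: rat poly. degree p = m \<and>
            (\<forall>w. theta_coeff m w = poly (map_poly of_rat p) w)) \<and>
         (\<exists>p :: int poly. (\<forall>i. coeff p i \<ge> 0) \<and>
            degree p = m \<and> lead_coeff p = 2 ^ m \<and> coeff p 0 = 0 \<and>
            (\<forall>w. theta_coeff_star m w = poly (map_poly of_int p) w))"
proof -
  obtain p :: "int poly" where p: "\<forall>i. coeff p i \<ge> 0" "degree p = m" "lead_coeff p = 2 ^ m"
    "coeff p 0 = 0" "\<And>w. theta_coeff_star m w = poly (map_poly of_int p) w"
    using theta_coeff_star_poly[of m] assms by auto
  \<comment> \<open>Solving the definition of \<open>theta_coeff_star\<close> for the coefficient
    gives the factor \<open>(-1) ^ m / fact m\<close>; the sign \<open>(-1) ^ i\<close> comes from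
    evaluating \<open>p\<close> at \<open>- w\<close>.\<close>
  define r :: "rat poly" where
    "r = Abs_poly (\<lambda>i. (-1) ^ m / fact m * (-1) ^ i * of_int (coeff p i))"
  have r: "coeff r i = (-1) ^ m / fact m * (-1) ^ i * of_int (coeff p i)" for i
    unfolding r_def
    by (subst coeff_Abs_poly[of m]) (use p(2) in \<open>auto simp: coeff_eq_0\<close>)
  have deg: "degree r = m"
  proof (rule antisym)
    show "degree r \<le> m" using p(2) by (intro degree_le) (auto simp: r coeff_eq_0)
    show "m \<le> degree r" using p(2,3) by (intro le_degree) (auto simp: r)
  qed
  have fact: "of_rat (fact m) = (fact m :: complex)"
    by (metis of_nat_fact of_rat_of_nat_eq)
  have "theta_coeff m w = poly (map_poly of_rat r) w" for w
  proof -
    have "theta_coeff m w = (-1) ^ m / fact m * theta_coeff_star m (- w)"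
      by (simp add: theta_coeff_star_def power_mult_distrib[symmetric])
    also have "\<dots> = (-1) ^ m / fact m * (\<Sum>i\<le>m. of_int (coeff p i) * (- w) ^ i)"
      using p(2) by (simp add: p(5) poly_altdef coeff_map_poly degree_map_poly)
    also have "\<dots> = (\<Sum>i\<le>m. of_rat (coeff r i) * w ^ i)"
      by (simp add: r sum_distrib_left of_rat_mult of_rat_divide of_rat_power of_rat_minus
            fact power_minus[of w] mult_ac)
    also have "\<dots> = poly (map_poly of_rat r) w"
      using deg by (simp add: poly_altdef coeff_map_poly degree_map_poly)
    finally show ?thesis .
  qed
  with deg p show ?thesis by blast
qed

end
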